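(* Assume $0<\overline V<1$ and $\mathbf E^-\prec\mathbf E^+$, i.e. $0<\kappa^-<\kappa^+$ and $0<\mu^-<\mu^+$. Let $\mathcal F_{\mathrm{ZO}}$ be the set of all $(\{c_j\}_{j=1}^{n_{lc}},\{\mathbf E_i\}_{i=1}^{n_e})$, $c_j\in\mathbb R$, $\mathbf E_i\in\mathbb S^{2\times2\times2\times2}$, such that $$\begin{pmatrix}c_j&-f_j^T\\-f_j&K_j(\{\mathbf E_i\})\end{pmatrix}\succeq0\ (j=1,\dots,n_{lc}),\quad\mathbf E^-\preceq\mathbf E_i\preceq\mathbf E^+\ (i=1,\dots,n_e),\quad\frac1{n_e}\sum_{i=1}^{n_e}\mathrm{Tr}(\mathbf E_i)\le\overline V\,\mathrm{Tr}(\mathbf E^+)+(1-\overline V)\mathrm{Tr}(\mathbf E^-).$$ Let $\mathcal F_{\mathrm{FO}}$ be the set of all $(\{c_j\},\{\mathbf E_i\})$ for which there exist $v_i^+\in[0,1]$, $i=1,\dots,n_e$, with $$\begin{pmatrix}c_j&-f_j^T\\-f_j&K_j(\{\mathbf E_i\})\end{pmatrix}\succeq0\ (j=1,\dots,n_{lc}),\quad\mathbf E^-\preceq\mathbf E_i\preceq(1-v_i^+)\mathbf E^-+v_i^+\mathbf E^+\ (i=1,\dots,n_e),\quad\frac1{n_e}\sum_{i=1}^{n_e}v_i^+\le\overline V.$$ Then $\mathcal F_{\mathrm{FO}}\subsetneq\mathcal F_{\mathrm{ZO}}$.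
   Context: $\mathbb S^{2\times2}$ is the space of real symmetric $2\times2$ matrices with the Frobenius inner product; $\mathbb S^{2\times2\times2\times2}$ is the space of fourth-order tensors acting as self-adjoint linear maps on $\mathbb S^{2\times2}$; $\preceq,\prec$ is the Loewner order. $\mathrm{Tr}(\mathbf E)$ is the trace of $\mathbf E$ as a linear map on $\mathbb S^{2\times2}$. $\mathbf E^\pm$ are isotropic, $\mathbf E^\pm\varepsilon=\kappa^\pm\mathrm{Tr}(\varepsilon)I+2\mu^\pm(\varepsilon-\tfrac12\mathrm{Tr}(\varepsilon)I)$. Finite-element setting: $n_e\ge1$ equisized elements, $n_{lc}\ge1$ loadcases, load vectors $f_j\in\mathbb R^{n_j}$, and assembled stiffness matrices $K_j(\{\mathbf E_i\})\in\mathbb R^{n_j\times n_j}$, symmetric, linear in $(\mathbf E_1,\dots,\mathbf E_{n_e})$, positive semidefinite if all $\mathbf E_i\succeq0$, and positive definite if all $\mathbf E_i\succ0$. *)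

theory Defs
  imports "HOL-Analysis.Analysis" "Jordan_Normal_Form.Matrix"
begin

section \<open>Symmetric $2\times2$ matrices with the Frobenius inner product\<close>

typedef sym2 = "{A :: real^2^2. Finite_Cartesian_Product.transpose A = A}"
  morphisms mat_of_sym2 sym2_of_mat
proof
  show "0 \<in> {A :: real^2^2. Finite_Cartesian_Product.transpose A = A}"
    by (simp add: Finite_Cartesian_Product.transpose_def Finite_Cartesian_Product.vec_eq_iff)
qed

setup_lifting type_definition_sym2

instantiation sym2 :: real_inner
begin

lift_definition zero_sym2 :: sym2 is 0
  by (simp add: Finite_Cartesian_Product.transpose_def Finite_Cartesian_Product.vec_eq_iff)
lift_definition plus_sym2 :: "sym2 \<Rightarrow> sym2 \<Rightarrow> sym2" is "(+)"
  by (simp add: Finite_Cartesian_Product.transpose_def Finite_Cartesian_Product.vec_eq_iff)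
lift_definition minus_sym2 :: "sym2 \<Rightarrow> sym2 \<Rightarrow> sym2" is "(-)"
  by (simp add: Finite_Cartesian_Product.transpose_def Finite_Cartesian_Product.vec_eq_iff)
lift_definition uminus_sym2 :: "sym2 \<Rightarrow> sym2" is uminus
  by (simp add: Finite_Cartesian_Product.transpose_def Finite_Cartesian_Product.vec_eq_iff)
lift_definition scaleR_sym2 :: "real \<Rightarrow> sym2 \<Rightarrow> sym2" is scaleR
  by (simp add: Finite_Cartesian_Product.transpose_def Finite_Cartesian_Product.vec_eq_iff)
\<comment> \<open>The inner product of \<^typ>\<open>real^2^2\<close> is the sum over all four entries.\<close>
lift_definition inner_sym2 :: "sym2 \<Rightarrow> sym2 \<Rightarrow> real" is inner .
definition norm_sym2 :: "sym2 \<Rightarrow> real" where "norm_sym2 x = sqrt (inner x x)"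
definition sgn_sym2 :: "sym2 \<Rightarrow> sym2" where "sgn_sym2 x = inverse (norm x) *\<^sub>R x"
definition dist_sym2 :: "sym2 \<Rightarrow> sym2 \<Rightarrow> real" where "dist_sym2 x y = norm (x - y)"
definition uniformity_sym2 :: "(sym2 \<times> sym2) filter"
  where "uniformity_sym2 = (INF e\<in>{0<..}. principal {(x, y). dist x y < e})"
definition open_sym2 :: "sym2 set \<Rightarrow> bool"
  where "open_sym2 U \<longleftrightarrow> (\<forall>x\<in>U. \<forall>\<^sub>F (x', y) in uniformity. x' = x \<longrightarrow> y \<in> U)"

instance
proof
  fix x y z :: sym2 and a b :: real
  show "x + y + z = x + (y + z)" "x + y = y + x" "0 + x = x" "- x + x = 0" "x - y = x + - y"
    "a *\<^sub>R (x + y) = a *\<^sub>R x + a *\<^sub>R y" "(a + b) *\<^sub>R x = a *\<^sub>R x + b *\<^sub>R x"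
    "a *\<^sub>R b *\<^sub>R x = (a * b) *\<^sub>R x" "1 *\<^sub>R x = x"
    by (simp_all add: mat_of_sym2_inject[symmetric] plus_sym2.rep_eq minus_sym2.rep_eq
        uminus_sym2.rep_eq zero_sym2.rep_eq scaleR_sym2.rep_eq scaleR_add_left scaleR_add_right)
  show "inner x y = inner y x" "inner (x + y) z = inner x z + inner y z"
    "inner (a *\<^sub>R x) y = a * inner x y" "0 \<le> inner x x" "inner x x = 0 \<longleftrightarrow> x = 0"
    by (simp_all add: mat_of_sym2_inject[symmetric] inner_sym2.rep_eq plus_sym2.rep_eq
        zero_sym2.rep_eq scaleR_sym2.rep_eq inner_add_left)
      (rule inner_commute)
qed (simp_all only: norm_sym2_def sgn_sym2_def dist_sym2_def uniformity_sym2_def open_sym2_def)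

end

definition mat22 :: "real \<Rightarrow> real \<Rightarrow> real \<Rightarrow> real \<Rightarrow> real^2^2"
  where "mat22 a b c d = (\<chi> i j. if i = 1 then (if j = 1 then a else b) else (if j = 1 then c else d))"

lift_definition mk_sym2 :: "real \<Rightarrow> real \<Rightarrow> real \<Rightarrow> sym2" is "\<lambda>a b d. mat22 a b b d"
  by (simp add: Finite_Cartesian_Product.transpose_def Finite_Cartesian_Product.vec_eq_iff mat22_def forall_2)

lemma mk_sym2_exhaust: obtains a b d where "x = mk_sym2 a b d"
proof -
  let ?A = "mat_of_sym2 x"
  have A: "Finite_Cartesian_Product.transpose ?A = ?A"
    using mat_of_sym2[of x] by blast
  have "vec_nth (vec_nth (Finite_Cartesian_Product.transpose ?A) 2) 1 = vec_nth (vec_nth ?A 1) 2"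
    by (simp add: Finite_Cartesian_Product.transpose_def)
  then have "vec_nth (vec_nth ?A 2) 1 = vec_nth (vec_nth ?A 1) 2"
    unfolding A .
  then have "x = mk_sym2 (vec_nth (vec_nth ?A 1) 1) (vec_nth (vec_nth ?A 1) 2) (vec_nth (vec_nth ?A 2) 2)"
    by (simp add: mat_of_sym2_inject[symmetric] mk_sym2.rep_eq mat22_def
        Finite_Cartesian_Product.vec_eq_iff forall_2)
  with that show thesis by blast
qed


lemma mk_sym2_arith:
  "mk_sym2 a b d + mk_sym2 a' b' d' = mk_sym2 (a + a') (b + b') (d + d')"
  "mk_sym2 a b d - mk_sym2 a' b' d' = mk_sym2 (a - a') (b - b') (d - d')"
  "r *\<^sub>R mk_sym2 a b d = mk_sym2 (r * a) (r * b) (r * d)"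
  "0 = mk_sym2 0 0 0"
  by (transfer; simp add: mat22_def Finite_Cartesian_Product.vec_eq_iff forall_2)+

lemma inner_mk_sym2:
  "inner (mk_sym2 a b d) (mk_sym2 a' b' d') = a * a' + 2 * b * b' + d * d'"
  by transfer (simp add: mat22_def inner_vec_def sum_2)

lemma mk_sym2_eq_iff: "mk_sym2 a b d = mk_sym2 a' b' d' \<longleftrightarrow> a = a' \<and> b = b' \<and> d = d'"
  by transfer (auto simp: mat22_def Finite_Cartesian_Product.vec_eq_iff forall_2)

instantiation sym2 :: euclidean_space
begin

definition Basis_sym2 :: "sym2 set"
  where "Basis_sym2 = {mk_sym2 1 0 0, mk_sym2 0 (1 / sqrt 2) 0, mk_sym2 0 0 1}"

instance
proof
  fix x u v :: sym2
  show "(Basis :: sym2 set) \<noteq> {}" "finite (Basis :: sym2 set)"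
    by (simp_all add: Basis_sym2_def)
  show "inner u v = (if u = v then 1 else 0)" if "u \<in> Basis" "v \<in> Basis"
    using that by (auto simp: Basis_sym2_def inner_mk_sym2 mk_sym2_eq_iff)
  show "(\<forall>u\<in>Basis. inner x u = 0) \<longleftrightarrow> x = 0"
    by (cases x rule: mk_sym2_exhaust)
      (auto simp: Basis_sym2_def inner_mk_sym2 mk_sym2_eq_iff mk_sym2_arith(4))
qed

end

lift_definition tr_sym2 :: "sym2 \<Rightarrow> real" is Determinants.trace .
lift_definition id_sym2 :: sym2 is "Finite_Cartesian_Product.mat 1"
  by (simp add: transpose_mat)

lemma tr_mk_sym2: "tr_sym2 (mk_sym2 a b d) = a + d"
  by transfer (simp add: Determinants.trace_def mat22_def sum_2)

lemma id_mk_sym2: "id_sym2 = mk_sym2 1 0 1"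
  by transfer (simp add: Finite_Cartesian_Product.mat_def mat22_def Finite_Cartesian_Product.vec_eq_iff forall_2)


section \<open>Fourth-order tensors as self-adjoint linear maps\<close>

typedef tensor4 =
  "{E :: sym2 \<Rightarrow> sym2. linear E \<and> (\<forall>x y. inner (E x) y = inner x (E y))}"
  morphisms tapp tensor4_of_fun
  by (rule exI[of _ "\<lambda>_. 0"]) (simp add: linear_zero)

setup_lifting type_definition_tensor4

instantiation tensor4 :: real_vector
begin

lift_definition zero_tensor4 :: tensor4 is "\<lambda>_. 0"
  by (simp add: linear_zero)
lift_definition plus_tensor4 :: "tensor4 \<Rightarrow> tensor4 \<Rightarrow> tensor4" is "\<lambda>E F x. E x + F x"
  by (simp add: linear_compose_add inner_add_left inner_add_right)
lift_definition minus_tensor4 :: "tensor4 \<Rightarrow> tensor4 \<Rightarrow> tensor4" is "\<lambda>E F x. E x - F x"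
  by (simp add: linear_compose_sub inner_diff_left inner_diff_right)
lift_definition uminus_tensor4 :: "tensor4 \<Rightarrow> tensor4" is "\<lambda>E x. - E x"
  by (simp add: linear_compose_neg)
lift_definition scaleR_tensor4 :: "real \<Rightarrow> tensor4 \<Rightarrow> tensor4" is "\<lambda>r E x. r *\<^sub>R E x"
  by (simp add: linear_compose_scale_right)

instance
  by standard (transfer; auto simp: fun_eq_iff algebra_simps)+

end

text \<open>The trace of a linear map on the three-dimensional space \<^typ>\<open>sym2\<close>.\<close>

definition Tr :: "tensor4 \<Rightarrow> real"
  where "Tr E = (\<Sum>b\<in>Basis. inner b (tapp E b))"

definition loewner_le :: "tensor4 \<Rightarrow> tensor4 \<Rightarrow> bool" (infix \<open>\<preceq>\<^sub>L\<close> 50)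
  where "E \<preceq>\<^sub>L F \<longleftrightarrow> (\<forall>x. 0 \<le> inner x (tapp (F - E) x))"

definition loewner_less :: "tensor4 \<Rightarrow> tensor4 \<Rightarrow> bool" (infix \<open>\<prec>\<^sub>L\<close> 50)
  where "E \<prec>\<^sub>L F \<longleftrightarrow> (\<forall>x. x \<noteq> 0 \<longrightarrow> 0 < inner x (tapp (F - E) x))"

lift_definition isotropic :: "real \<Rightarrow> real \<Rightarrow> tensor4" is
  "\<lambda>\<kappa> \<mu> \<epsilon>. (\<kappa> * tr_sym2 \<epsilon>) *\<^sub>R id_sym2 + (2 * \<mu>) *\<^sub>R (\<epsilon> - (1 / 2 * tr_sym2 \<epsilon>) *\<^sub>R id_sym2)"
proof (intro conjI linearI allI)
  fix \<kappa> \<mu> r :: real and x y :: sym2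
  obtain a b d where x: "x = mk_sym2 a b d" by (rule mk_sym2_exhaust)
  obtain a' b' d' where y: "y = mk_sym2 a' b' d'" by (rule mk_sym2_exhaust)
  let ?E = "\<lambda>\<epsilon>. (\<kappa> * tr_sym2 \<epsilon>) *\<^sub>R id_sym2 + (2 * \<mu>) *\<^sub>R (\<epsilon> - (1 / 2 * tr_sym2 \<epsilon>) *\<^sub>R id_sym2)"
  show "?E (x + y) = ?E x + ?E y" "?E (r *\<^sub>R x) = r *\<^sub>R ?E x"
    "inner (?E x) y = inner x (?E y)"
    by (simp_all add: x y id_mk_sym2 mk_sym2_arith tr_mk_sym2 mk_sym2_eq_iff inner_mk_sym2
        field_simps)
qed

text \<open>For isotropic tensors the Loewner order is the order of the moduli.\<close>

lemma isotropic_quadratic_form: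
  "inner (mk_sym2 a b d) (tapp (isotropic \<kappa> \<mu>) (mk_sym2 a b d))
    = \<kappa> * (a + d)^2 + \<mu> * ((a - d)^2 + 4 * b^2)"
  by (simp add: isotropic.rep_eq id_mk_sym2 mk_sym2_arith tr_mk_sym2 inner_mk_sym2
      field_simps power2_eq_square)

lemma isotropic_diff: "isotropic \<kappa>' \<mu>' - isotropic \<kappa> \<mu> = isotropic (\<kappa>' - \<kappa>) (\<mu>' - \<mu>)"
  by transfer (simp add: fun_eq_iff algebra_simps)

lemma isotropic_loewner_less_iff:
  "isotropic \<kappa> \<mu> \<prec>\<^sub>L isotropic \<kappa>' \<mu>' \<longleftrightarrow> \<kappa> < \<kappa>' \<and> \<mu> < \<mu>'"
proof
  assume *: "isotropic \<kappa> \<mu> \<prec>\<^sub>L isotropic \<kappa>' \<mu>'"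
  have **: "0 < (\<kappa>' - \<kappa>) * (a + d)^2 + (\<mu>' - \<mu>) * ((a - d)^2 + 4 * b^2)"
    if "a \<noteq> 0 \<or> b \<noteq> 0 \<or> d \<noteq> 0" for a b d
    using * that unfolding loewner_less_def isotropic_diff
    by (metis isotropic_quadratic_form mk_sym2_arith(4) mk_sym2_eq_iff)
  show "\<kappa> < \<kappa>' \<and> \<mu> < \<mu>'"
    using **[of 1 0 1] **[of 0 1 0] by simp
next
  assume *: "\<kappa> < \<kappa>' \<and> \<mu> < \<mu>'"
  show "isotropic \<kappa> \<mu> \<prec>\<^sub>L isotropic \<kappa>' \<mu>'"
    unfolding loewner_less_def isotropic_diff
  proof (intro allI impI)
    fix x :: sym2 assume "x \<noteq> 0"
    obtain a b d where x: "x = mk_sym2 a b d" by (rule mk_sym2_exhaust)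
    with \<open>x \<noteq> 0\<close> have "a + d \<noteq> 0 \<or> a - d \<noteq> 0 \<or> b \<noteq> 0"
      by (auto simp: mk_sym2_arith(4) mk_sym2_eq_iff)
    have "0 < (\<kappa>' - \<kappa>) * (a + d)^2 + (\<mu>' - \<mu>) * ((a - d)^2 + 4 * b^2)"
    proof (cases "a + d = 0")
      case True
      with \<open>a + d \<noteq> 0 \<or> a - d \<noteq> 0 \<or> b \<noteq> 0\<close> have "0 < (a - d)^2 + 4 * b^2"
        by (auto simp: add_pos_nonneg add_nonneg_pos)
      with * show ?thesis by (simp add: True)
    next
      case False
      with * show ?thesis by (intro add_pos_nonneg mult_pos_pos mult_nonneg_nonneg) auto
    qed
    then show "0 < inner x (tapp (isotropic (\<kappa>' - \<kappa>) (\<mu>' - \<mu>)) x)"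
      unfolding x isotropic_quadratic_form .
  qed
qed


section \<open>Stiffness matrices and the feasible sets\<close>

definition pos_semidef :: "real mat \<Rightarrow> bool"
  where "pos_semidef A \<longleftrightarrow> square_mat A \<and> A\<^sup>T = A \<and>
    (\<forall>x\<in>carrier_vec (dim_row A). 0 \<le> scalar_prod x (A *\<^sub>v x))"

definition pos_def :: "real mat \<Rightarrow> bool"
  where "pos_def A \<longleftrightarrow> square_mat A \<and> A\<^sup>T = A \<and>
    (\<forall>x\<in>carrier_vec (dim_row A). x \<noteq> 0\<^sub>v (dim_row A) \<longrightarrow> 0 < scalar_prod x (A *\<^sub>v x))"

text \<open>Properties of an assembled \<open>n \<times> n\<close> stiffness matrix as a function of the element tensors;
  linearity is joint in all tensors \<open>E i\<close>.\<close>

definition stiffness_map :: "nat \<Rightarrow> (('e \<Rightarrow> tensor4) \<Rightarrow> real mat) \<Rightarrow> bool"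
  where "stiffness_map n K \<longleftrightarrow>
    (\<forall>E. K E \<in> carrier_mat n n \<and> (K E)\<^sup>T = K E) \<and>
    (\<forall>E F. K (\<lambda>i. E i + F i) = K E + K F) \<and>
    (\<forall>r E. K (\<lambda>i. r *\<^sub>R E i) = r \<cdot>\<^sub>m K E) \<and>
    (\<forall>E. (\<forall>i. 0 \<preceq>\<^sub>L E i) \<longrightarrow> pos_semidef (K E)) \<and>
    (\<forall>E. (\<forall>i. 0 \<prec>\<^sub>L E i) \<longrightarrow> pos_def (K E))"

definition compliance_block :: "real \<Rightarrow> real vec \<Rightarrow> real mat \<Rightarrow> real mat"
  where "compliance_block c f K =
    four_block_mat (mat 1 1 (\<lambda>_. c)) (mat_of_row (- f)) (mat_of_row (- f))\<^sup>T K"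

definition F_ZO ::
  "('l \<Rightarrow> real vec) \<Rightarrow> ('l \<Rightarrow> ('e::finite \<Rightarrow> tensor4) \<Rightarrow> real mat) \<Rightarrow> tensor4 \<Rightarrow> tensor4 \<Rightarrow> real
    \<Rightarrow> (('l \<Rightarrow> real) \<times> ('e \<Rightarrow> tensor4)) set"
  where "F_ZO f K Em Ep V = {(c, E).
    (\<forall>j. pos_semidef (compliance_block (c j) (f j) (K j E))) \<and>
    (\<forall>i. Em \<preceq>\<^sub>L E i \<and> E i \<preceq>\<^sub>L Ep) \<and>
    1 / real CARD('e) * (\<Sum>i\<in>UNIV. Tr (E i)) \<le> V * Tr Ep + (1 - V) * Tr Em}"

definition F_FO ::
  "('l \<Rightarrow> real vec) \<Rightarrow> ('l \<Rightarrow> ('e::finite \<Rightarrow> tensor4) \<Rightarrow> real mat) \<Rightarrow> tensor4 \<Rightarrow> tensor4 \<Rightarrow> real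
    \<Rightarrow> (('l \<Rightarrow> real) \<times> ('e \<Rightarrow> tensor4)) set"
  where "F_FO f K Em Ep V = {(c, E). \<exists>v :: 'e \<Rightarrow> real.
    (\<forall>i. 0 \<le> v i \<and> v i \<le> 1) \<and>
    (\<forall>j. pos_semidef (compliance_block (c j) (f j) (K j E))) \<and>
    (\<forall>i. Em \<preceq>\<^sub>L E i \<and> E i \<preceq>\<^sub>L (1 - v i) *\<^sub>R Em + v i *\<^sub>R Ep) \<and>
    1 / real CARD('e) * (\<Sum>i\<in>UNIV. v i) \<le> V}"

end

(*
  Inclusion follows because the volume fractions of FO turn the upper Loewner bound into the trace
  bound of ZO. For strictness take all elements equal to one isotropic tensor whose bulk modulus
  lies slightly above, and whose shear modulus slightly below, the mixture with volume fraction V,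
  balanced so that the trace constraint stays tight. The Loewner bound then forces every volume
  fraction above V. The tensor is positive definite, so K u = f is solvable and the compliances
  c = f . u complete the feasible point.
*)
theory Submission
  imports Defs "Jordan_Normal_Form.Determinant"
begin

section \<open>The Loewner order and the trace\<close>

lemma loewner_le_alt: "E \<preceq>\<^sub>L F \<longleftrightarrow> (\<forall>x. inner x (tapp E x) \<le> inner x (tapp F x))"
  by (simp add: loewner_le_def minus_tensor4.rep_eq inner_diff_right)

lemma loewner_le_trans: "E \<preceq>\<^sub>L F \<Longrightarrow> F \<preceq>\<^sub>L G \<Longrightarrow> E \<preceq>\<^sub>L G"
  unfolding loewner_le_alt by (meson order_trans)

lemma Tr_mono: "E \<preceq>\<^sub>L F \<Longrightarrow> Tr E \<le> Tr F"
  unfolding Tr_def loewner_le_alt by (intro sum_mono) simp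

lemma isotropic_mixture:
  "(1 - v) *\<^sub>R isotropic \<kappa> \<mu> + v *\<^sub>R isotropic \<kappa>' \<mu>'
    = isotropic (\<kappa> + v * (\<kappa>' - \<kappa>)) (\<mu> + v * (\<mu>' - \<mu>))"
  by transfer (simp add: fun_eq_iff algebra_simps)

lemma zero_eq_isotropic: "0 = isotropic 0 0"
  by transfer (simp add: fun_eq_iff)

text \<open>The quadratic form of an isotropic tensor is a sum of a volumetric and a deviatoric
  square weighted by the two moduli, and each square can be made to vanish separately.\<close>

lemma isotropic_loewner_le_iff:
  "isotropic \<kappa> \<mu> \<preceq>\<^sub>L isotropic \<kappa>' \<mu>' \<longleftrightarrow> \<kappa> \<le> \<kappa>' \<and> \<mu> \<le> \<mu>'"
proof
  assume le: "isotropic \<kappa> \<mu> \<preceq>\<^sub>L isotropic \<kappa>' \<mu>'"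
  have "0 \<le> (\<kappa>' - \<kappa>) * (a + d)^2 + (\<mu>' - \<mu>) * ((a - d)^2 + 4 * b^2)" for a b d
    using le unfolding loewner_le_def isotropic_diff
    by (metis isotropic_quadratic_form)
  \<comment> \<open>The variables occur in the order \<open>a\<close>, \<open>d\<close>,
    \<open>b\<close>: the first instance is the identity matrix, the second a pure shear.\<close>
  from this[of 1 1 0] this[of 0 0 1] show "\<kappa> \<le> \<kappa>' \<and> \<mu> \<le> \<mu>'" by simp
next
  assume le: "\<kappa> \<le> \<kappa>' \<and> \<mu> \<le> \<mu>'"
  show "isotropic \<kappa> \<mu> \<preceq>\<^sub>L isotropic \<kappa>' \<mu>'"
    unfolding loewner_le_def isotropic_diff
  proof
    fix x :: sym2
    obtain a b d where x: "x = mk_sym2 a b d" by (rule mk_sym2_exhaust)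
    show "0 \<le> inner x (tapp (isotropic (\<kappa>' - \<kappa>) (\<mu>' - \<mu>)) x)"
      unfolding x isotropic_quadratic_form using le by simp
  qed
qed

text \<open>The eigenvalue 2 \<open>\<kappa>\<close> belongs to the line of multiples of the
  identity, the eigenvalue 2 \<open>\<mu>\<close> to the plane of trace-free matrices.\<close>

lemma Tr_isotropic: "Tr (isotropic \<kappa> \<mu>) = 2 * \<kappa> + 4 * \<mu>"
  by (simp add: Tr_def Basis_sym2_def mk_sym2_eq_iff isotropic_quadratic_form power_divide)

section \<open>Compliance blocks\<close>

text \<open>A nonzero kernel vector would have a vanishing quadratic form, so the determinant is
  nonzero and an inverse exists.\<close>

lemma pos_def_solvable:
  assumes K: "K \<in> carrier_mat n n" and pd: "pos_def K" and f: "f \<in> carrier_vec n"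
  obtains u where "u \<in> carrier_vec n" "K *\<^sub>v u = f"
proof -
  have "det K \<noteq> 0"
  proof
    assume "det K = 0"
    then obtain v where v: "v \<in> carrier_vec n" "v \<noteq> 0\<^sub>v n" "K *\<^sub>v v = 0\<^sub>v n"
      using det_0_iff_vec_prod_zero_field[OF K] by blast
    then have "0 < scalar_prod v (K *\<^sub>v v)"
      using pd K by (auto simp: pos_def_def)
    with v show False by simp
  qed
  \<comment> \<open>The unit fills the record extension slot of \<open>ring_mat\<close>.\<close>
  from det_non_zero_imp_unit[OF K this, of "()"]
  obtain B where B: "B \<in> carrier_mat n n" "K * B = 1\<^sub>m n"
    by (auto simp: Units_def ring_mat_def)
  show thesis
  proof
    show "B *\<^sub>v f \<in> carrier_vec n" using B f by simp
    show "K *\<^sub>v (B *\<^sub>v f) = f"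
      using assoc_mult_mat_vec[OF K B(1) f] B(2) f by simp
  qed
qed

text \<open>The two off-diagonal blocks are transposes of each other and contribute equally, hence
  the factor 2.\<close>

lemma compliance_block_quadratic_form:
  assumes f: "f \<in> carrier_vec n" and K: "K \<in> carrier_mat n n" and x: "x \<in> carrier_vec n"
    and a: "a \<in> carrier_vec 1"
  shows "scalar_prod (a @\<^sub>v x) (compliance_block c f K *\<^sub>v (a @\<^sub>v x))
    = c * (vec_index a 0)^2 - 2 * vec_index a 0 * scalar_prod f x + scalar_prod x (K *\<^sub>v x)"
proof -
  let ?A = "mat 1 1 (\<lambda>_. c)" and ?B = "mat_of_row (- f)"
  have A: "?A \<in> carrier_mat 1 1" by simp
  have B: "?B \<in> carrier_mat 1 n" using f by simp
  then have BT: "?B\<^sup>T \<in> carrier_mat n 1" by simp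
  note Aa = mult_mat_vec_carrier[OF A a] and Bx = mult_mat_vec_carrier[OF B x]
    and BTa = mult_mat_vec_carrier[OF BT a] and Kx = mult_mat_vec_carrier[OF K x]
  have aA: "scalar_prod a (?A *\<^sub>v a) = c * (vec_index a 0)^2"
    using a by (simp add: scalar_prod_def power2_eq_square)
  have aB: "scalar_prod a (?B *\<^sub>v x) = - (vec_index a 0 * scalar_prod f x)"
    using a f x by (simp add: scalar_prod_def sum_negf)
  have "scalar_prod x (?B\<^sup>T *\<^sub>v a) = scalar_prod (?B\<^sup>T *\<^sub>v a) x"
    by (rule comm_scalar_prod[OF x BTa])
  also have "\<dots> = scalar_prod a (?B *\<^sub>v x)"
    by (rule transpose_vec_mult_scalar[OF B x a])
  finally have xBTa: "scalar_prod x (?B\<^sup>T *\<^sub>v a) = scalar_prod a (?B *\<^sub>v x)" .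
  have "scalar_prod (a @\<^sub>v x) (compliance_block c f K *\<^sub>v (a @\<^sub>v x))
    = scalar_prod (a @\<^sub>v x) ((?A *\<^sub>v a + ?B *\<^sub>v x) @\<^sub>v (?B\<^sup>T *\<^sub>v a + K *\<^sub>v x))"
    unfolding compliance_block_def by (subst four_block_mat_mult_vec[OF A B BT K a x]) simp
  also have "\<dots> = scalar_prod a (?A *\<^sub>v a + ?B *\<^sub>v x) + scalar_prod x (?B\<^sup>T *\<^sub>v a + K *\<^sub>v x)"
    by (rule scalar_prod_append[OF a x add_carrier_vec[OF Aa Bx] add_carrier_vec[OF BTa Kx]])
  also have "scalar_prod a (?A *\<^sub>v a + ?B *\<^sub>v x) = scalar_prod a (?A *\<^sub>v a) + scalar_prod a (?B *\<^sub>v x)"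
    by (rule scalar_prod_add_distrib[OF a Aa Bx])
  also have "scalar_prod x (?B\<^sup>T *\<^sub>v a + K *\<^sub>v x) = scalar_prod x (?B\<^sup>T *\<^sub>v a) + scalar_prod x (K *\<^sub>v x)"
    by (rule scalar_prod_add_distrib[OF x BTa Kx])
  finally show ?thesis
    unfolding xBTa aA aB by simp
qed

text \<open>The sufficient direction of the Schur complement criterion, with the load written as
  \<open>K *\<^sub>v u\<close> so that no inverse appears.\<close>

lemma compliance_block_pos_semidef:
  assumes u: "u \<in> carrier_vec n" and K: "K \<in> carrier_mat n n" and psd: "pos_semidef K"
  shows "pos_semidef (compliance_block (scalar_prod (K *\<^sub>v u) u) (K *\<^sub>v u) K)"
proof -
  let ?f = "K *\<^sub>v u"
  let ?c = "scalar_prod ?f u"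
  let ?M = "compliance_block ?c ?f K"
  have f: "?f \<in> carrier_vec n" using mult_mat_vec_carrier[OF K u] .
  have KT: "K\<^sup>T = K" using psd by (simp add: pos_semidef_def)
  have M: "?M \<in> carrier_mat (1 + n) (1 + n)"
    unfolding compliance_block_def using K by (intro four_block_carrier_mat) auto
  have B: "mat_of_row (- ?f) \<in> carrier_mat 1 n" using f by simp
  then have BT: "(mat_of_row (- ?f))\<^sup>T \<in> carrier_mat n 1" by simp
  have A: "mat 1 1 (\<lambda>_. ?c) \<in> carrier_mat 1 1" by simp
  have A1: "(mat 1 1 (\<lambda>_. ?c))\<^sup>T = mat 1 1 (\<lambda>_. ?c)" by auto
  have MT: "?M\<^sup>T = ?M"
    unfolding compliance_block_def transpose_four_block_mat[OF A B BT K] KT A1 transpose_transpose ..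
  have "0 \<le> scalar_prod y (?M *\<^sub>v y)" if y: "y \<in> carrier_vec (1 + n)" for y
  proof -
    define a x where "a = vec_first y 1" and "x = vec_last y n"
    have a: "a \<in> carrier_vec 1" and x: "x \<in> carrier_vec n" and yax: "y = a @\<^sub>v x"
      using y by (simp_all add: a_def x_def)
    define t where "t = vec_index a 0"
    \<comment> \<open>Completing the square: with this shift the form of the block at
      \<open>y\<close> is exactly the form of \<open>K\<close> at \<open>w\<close>.\<close>
    define w where "w = x - t \<cdot>\<^sub>v u"
    have w: "w \<in> carrier_vec n" using x u by (simp add: w_def)
    have tu: "t \<cdot>\<^sub>v u \<in> carrier_vec n" and tf: "t \<cdot>\<^sub>v ?f \<in> carrier_vec n"
      and Kx: "K *\<^sub>v x \<in> carrier_vec n"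
      using u f mult_mat_vec_carrier[OF K x] by auto
    have Kw: "K *\<^sub>v w = K *\<^sub>v x - t \<cdot>\<^sub>v ?f"
      unfolding w_def mult_minus_distrib_mat_vec[OF K x tu] mult_mat_vec[OF K u] ..
    have uKx: "scalar_prod u (K *\<^sub>v x) = scalar_prod ?f x"
      using transpose_vec_mult_scalar[OF K x u] KT by simp
    have "scalar_prod w (K *\<^sub>v w) = scalar_prod x (K *\<^sub>v x) - t * scalar_prod x ?f
        - t * scalar_prod u (K *\<^sub>v x) + t * (t * scalar_prod u ?f)"
      unfolding Kw scalar_prod_minus_distrib[OF w Kx tf]
      unfolding w_def minus_scalar_prod_distrib[OF x tu Kx] minus_scalar_prod_distrib[OF x tu tf]
      using x u f Kx tf by (simp add: algebra_simps)
    also have "\<dots> = scalar_prod y (?M *\<^sub>v y)"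
      unfolding yax compliance_block_quadratic_form[OF f K x a] t_def[symmetric] uKx
      by (simp add: comm_scalar_prod[OF x f] comm_scalar_prod[OF u f] power2_eq_square)
    finally have "scalar_prod w (K *\<^sub>v w) = scalar_prod y (?M *\<^sub>v y)" .
    with psd w K show ?thesis by (auto simp: pos_semidef_def)
  qed
  with M MT show ?thesis by (simp add: pos_semidef_def)
qed

text \<open>The compliance is the work \<open>f\<close> . \<open>u\<close> of the load on the
  displacement \<open>u\<close> solving the equilibrium equation.\<close>

lemma stiffness_map_feasible_compliance:
  assumes "f \<in> carrier_vec n" and "stiffness_map n K" and "\<And>i. 0 \<prec>\<^sub>L E i"
  shows "\<exists>c. pos_semidef (compliance_block c f (K E))"
proof -
  have K: "K E \<in> carrier_mat n n" and pd: "pos_def (K E)"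
    using assms by (auto simp: stiffness_map_def)
  have "0 \<preceq>\<^sub>L E i" for i
    using assms(3)[of i] unfolding loewner_le_def loewner_less_def
    by (metis inner_zero_left order_le_less)
  then have psd: "pos_semidef (K E)"
    using assms by (auto simp: stiffness_map_def)
  obtain u where "u \<in> carrier_vec n" "K E *\<^sub>v u = f"
    using pos_def_solvable[OF K pd assms(1)] .
  then show ?thesis
    using compliance_block_pos_semidef[OF _ K psd] by metis
qed

section \<open>Comparison of the feasible sets\<close>

lemma F_FO_subset_F_ZO:
  fixes K :: "'l \<Rightarrow> ('e::finite \<Rightarrow> tensor4) \<Rightarrow> real mat"
  assumes "\<kappa>m \<le> \<kappa>p" and "\<mu>m \<le> \<mu>p"
  shows "F_FO f K (isotropic \<kappa>m \<mu>m) (isotropic \<kappa>p \<mu>p) V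
    \<subseteq> F_ZO f K (isotropic \<kappa>m \<mu>m) (isotropic \<kappa>p \<mu>p) V"
proof clarify
  fix c E
  let ?m = "isotropic \<kappa>m \<mu>m" and ?p = "isotropic \<kappa>p \<mu>p"
  \<comment> \<open>\<open>D\<close> is the trace gap between the two materials, the slope of the
    trace of the mixture in the volume fraction.\<close>
  define D where "D = 2 * (\<kappa>p - \<kappa>m) + 4 * (\<mu>p - \<mu>m)"
  have "0 \<le> D" using assms by (simp add: D_def)
  assume "(c, E) \<in> F_FO f K ?m ?p V"
  then obtain v :: "'e \<Rightarrow> real" where v: "\<And>i. 0 \<le> v i" "\<And>i. v i \<le> 1"
    and psd: "\<And>j. pos_semidef (compliance_block (c j) (f j) (K j E))"
    and lower: "\<And>i. ?m \<preceq>\<^sub>L E i" and upper: "\<And>i. E i \<preceq>\<^sub>L (1 - v i) *\<^sub>R ?m + v i *\<^sub>R ?p"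
    and vol: "1 / real CARD('e) * (\<Sum>i\<in>UNIV. v i) \<le> V"
    by (auto simp: F_FO_def)
  \<comment> \<open>A fraction of at most 1 keeps both moduli of the mixture below those of the
    stiff material.\<close>
  have "(1 - v i) *\<^sub>R ?m + v i *\<^sub>R ?p \<preceq>\<^sub>L ?p" for i
    unfolding isotropic_mixture isotropic_loewner_le_iff
    using mult_right_mono[OF v(2)[of i], of "\<kappa>p - \<kappa>m"]
      mult_right_mono[OF v(2)[of i], of "\<mu>p - \<mu>m"] assms by simp
  then have le: "E i \<preceq>\<^sub>L ?p" for i
    using upper loewner_le_trans by blast
  have "Tr (E i) \<le> Tr ?m + v i * D" for i
    using Tr_mono[OF upper[of i]] unfolding isotropic_mixture Tr_isotropic D_def
    by (simp add: algebra_simps)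
  then have "(\<Sum>i\<in>UNIV. Tr (E i)) \<le> (\<Sum>i\<in>(UNIV :: 'e set). Tr ?m + v i * D)"
    by (rule sum_mono)
  also have "\<dots> = real CARD('e) * Tr ?m + (\<Sum>i\<in>UNIV. v i) * D"
    by (simp add: sum.distrib sum_distrib_right)
  finally have "1 / real CARD('e) * (\<Sum>i\<in>UNIV. Tr (E i))
      \<le> Tr ?m + 1 / real CARD('e) * (\<Sum>i\<in>UNIV. v i) * D"
    by (simp add: field_simps)
  also have "\<dots> \<le> Tr ?m + V * D"
    using mult_right_mono[OF vol \<open>0 \<le> D\<close>] by simp
  also have "\<dots> = V * Tr ?p + (1 - V) * Tr ?m"
    by (simp add: Tr_isotropic D_def algebra_simps)
  finally show "(c, E) \<in> F_ZO f K ?m ?p V"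
    using psd lower le by (auto simp: F_ZO_def)
qed

theorem proposition3p2:
  fixes n :: "'l::finite \<Rightarrow> nat"
    and f :: "'l \<Rightarrow> real vec"
    and K :: "'l \<Rightarrow> ('e::finite \<Rightarrow> tensor4) \<Rightarrow> real mat"
    and \<kappa>m \<kappa>p \<mu>m \<mu>p V :: real
  assumes "\<And>j. f j \<in> carrier_vec (n j)"
    and "\<And>j. stiffness_map (n j) (K j)"
    and "0 < V" "V < 1"
    and "isotropic \<kappa>m \<mu>m \<prec>\<^sub>L isotropic \<kappa>p \<mu>p"
    and "0 < \<kappa>m" "\<kappa>m < \<kappa>p"
    and "0 < \<mu>m" "\<mu>m < \<mu>p"
  shows "F_FO f K (isotropic \<kappa>m \<mu>m) (isotropic \<kappa>p \<mu>p) V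
    \<subset> F_ZO f K (isotropic \<kappa>m \<mu>m) (isotropic \<kappa>p \<mu>p) V"
proof -
  let ?m = "isotropic \<kappa>m \<mu>m" and ?p = "isotropic \<kappa>p \<mu>p"
  define \<Delta>\<kappa> \<Delta>\<mu> where "\<Delta>\<kappa> = \<kappa>p - \<kappa>m" and "\<Delta>\<mu> = \<mu>p - \<mu>m"
  have pos: "0 < \<Delta>\<kappa>" "0 < \<Delta>\<mu>" using assms by (simp_all add: \<Delta>\<kappa>_def \<Delta>\<mu>_def)
  \<comment> \<open>The largest step that keeps the bulk fraction \<open>s\<close> at most 1 and the
    shear fraction \<open>r\<close> nonnegative.\<close>
  define e where "e = min ((1 - V) / (2 * \<Delta>\<mu>)) (V / \<Delta>\<kappa>)"
  have e: "0 < e" using pos assms by (simp add: e_def)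
  \<comment> \<open>The shifts have opposite signs and are scaled so that their trace contributions,
    2 \<open>\<Delta>\<kappa>\<close> (2 \<open>e\<close> \<open>\<Delta>\<mu>\<close>) and -4
    \<open>\<Delta>\<mu>\<close> (\<open>e\<close> \<open>\<Delta>\<kappa>\<close>), cancel.\<close>
  define s r where "s = V + e * (2 * \<Delta>\<mu>)" and "r = V - e * \<Delta>\<kappa>"
  have "e \<le> (1 - V) / (2 * \<Delta>\<mu>)" "e \<le> V / \<Delta>\<kappa>" by (simp_all add: e_def)
  then have "e * (2 * \<Delta>\<mu>) \<le> 1 - V" "e * \<Delta>\<kappa> \<le> V"
    using pos by (simp_all only: pos_le_divide_eq mult_pos_pos zero_less_numeral)
  moreover have "0 < e * (2 * \<Delta>\<mu>)" "0 < e * \<Delta>\<kappa>" using e pos by simp_all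
  ultimately have s: "V < s" "s \<le> 1" and r: "0 \<le> r" "r \<le> 1"
    using assms by (simp_all add: s_def r_def)
  define E0 where "E0 = isotropic (\<kappa>m + s * \<Delta>\<kappa>) (\<mu>m + r * \<Delta>\<mu>)"
  define E where "E = (\<lambda>_ :: 'e. E0)"
  have nn: "0 \<le> s * \<Delta>\<kappa>" "0 \<le> r * \<Delta>\<mu>" using s r pos assms by simp_all
  then have "0 \<prec>\<^sub>L E i" for i
    using assms by (simp add: E_def E0_def zero_eq_isotropic isotropic_loewner_less_iff)
  then have "\<forall>j. \<exists>c. pos_semidef (compliance_block c (f j) (K j E))"
    using stiffness_map_feasible_compliance assms(1,2) by blast
  then obtain c where c: "\<And>j. pos_semidef (compliance_block (c j) (f j) (K j E))"
    by metis
  have lower: "?m \<preceq>\<^sub>L E0"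
    using nn by (simp add: E0_def isotropic_loewner_le_iff)
  have upper: "E0 \<preceq>\<^sub>L ?p"
  proof -
    have "s * \<Delta>\<kappa> \<le> 1 * \<Delta>\<kappa>" "r * \<Delta>\<mu> \<le> 1 * \<Delta>\<mu>"
      using s(2) r(2) pos by (intro mult_right_mono; simp)+
    then have "\<kappa>m + s * \<Delta>\<kappa> \<le> \<kappa>p" "\<mu>m + r * \<Delta>\<mu> \<le> \<mu>p"
      using \<Delta>\<kappa>_def \<Delta>\<mu>_def by linarith+
    then show ?thesis
      by (simp only: E0_def isotropic_loewner_le_iff)
  qed
  have "1 / real CARD('e) * (\<Sum>i\<in>UNIV. Tr (E i)) = Tr E0"
    by (simp add: E_def)
  also have "\<dots> = V * Tr ?p + (1 - V) * Tr ?m"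
    by (simp add: E0_def Tr_isotropic s_def r_def \<Delta>\<kappa>_def \<Delta>\<mu>_def algebra_simps)
  finally have ZO: "(c, E) \<in> F_ZO f K ?m ?p V"
    using c lower upper by (simp add: F_ZO_def E_def)
  have "(c, E) \<notin> F_FO f K ?m ?p V"
  proof
    assume "(c, E) \<in> F_FO f K ?m ?p V"
    then obtain v :: "'e \<Rightarrow> real" where v: "\<And>i. E0 \<preceq>\<^sub>L (1 - v i) *\<^sub>R ?m + v i *\<^sub>R ?p"
      and vol: "1 / real CARD('e) * (\<Sum>i\<in>UNIV. v i) \<le> V"
      by (auto simp: F_FO_def E_def)
    \<comment> \<open>Only the bulk part of the bound matters: one scalar \<open>v i\<close> must
      cover both moduli, so it cannot profit from the lower shear fraction.\<close>
    have "s \<le> v i" for i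
      using v[of i] pos
      by (simp add: E0_def isotropic_mixture isotropic_loewner_le_iff flip: \<Delta>\<kappa>_def)
    \<comment> \<open>Averaging over the elements gives a mean fraction of at least
      \<open>s\<close>, which exceeds \<open>V\<close>.\<close>
    then have "(\<Sum>i\<in>(UNIV :: 'e set). s) \<le> (\<Sum>i\<in>UNIV. v i)"
      by (intro sum_mono)
    then have "s \<le> 1 / real CARD('e) * (\<Sum>i\<in>UNIV. v i)"
      by (simp add: field_simps)
    with vol s show False by simp
  qed
  with ZO show ?thesis
    using F_FO_subset_F_ZO[of \<kappa>m \<kappa>p \<mu>m \<mu>p f K V] assms by auto
qed

end
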